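(* The integrality gap of $[\mathrm{LP}(C)]$ in the case of unrelated machines is lower bounded by $1+\varphi \approx 2.618$, where $\varphi = \frac{1+\sqrt5}{2}$ is the golden ratio.
   Context: Scheduling malleable jobs on unrelated machines. An instance consists of a finite set $\mathcal{J}$ of jobs, a finite set $\mathcal{M}$ of machines, a speed $s_{i,j} \in \mathbb{Z}_+$ (non-negative integers) for each $i \in \mathcal{M}$, $j \in \mathcal{J}$, and for each job $j$ a processing time function $f_j$ defined on $\mathbb{R}_+$ with $f_j(0)=+\infty$, $f_j(s)\in\mathbb{R}_+$ for $s>0$, $f_j(s)$ non-increasing in $s$, and $s\cdot f_j(s)$ non-decreasing in $s>0$. For $S \subseteq \mathcal{M}$ let $\sigma_j(S) = \sum_{i \in S} s_{i,j}$ and $f_j(S) := f_j(\sigma_j(S))$. A feasible schedule chooses for each job $j$ a set $S_j \subseteq \mathcal{M}$ and a start time $\tau_j \ge 0$; job $j$ occupies all machines of $S_j$ (non-preemptively and in unison) during $[\tau_j, \tau_j + f_j(S_j)]$, and each machine processes at most one job at a time. The makespan is $\max_{j} (\tau_j + f_j(S_j))$ and $\mathrm{OPT}$ is the minimum makespan. For a target makespan $C > 0$ let $\gamma_j = \gamma_j(C) := \min\{q \in \mathbb{Z}_+ : f_j(q) \le C\}$ (assumed to exist for every $j$) and $r_{i,j} := \max\{s_{i,j}, \gamma_j(C)\}$. The feasibility program $[\mathrm{LP}(C)]$ in variables $x_{i,j}$ is: $\sum_{i \in \mathcal{M}} x_{i,j} = 1$ for all $j \in \mathcal{J}$; $\sum_{j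 \in \mathcal{J}} \frac{f_j(r_{i,j})\, r_{i,j}}{s_{i,j}} x_{i,j} \le C$ for all $i \in \mathcal{M}$; $x_{i,j} \ge 0$ for all $i,j$. Convention: $x_{i,j} = 0$ is required whenever $s_{i,j} = 0$ (and that term is dropped from the sum). The integrality gap of $[\mathrm{LP}(C)]$ is the supremum over all instances of the ratio $\mathrm{OPT}/C^*$, where $C^*$ is the infimum of all $C>0$ for which $[\mathrm{LP}(C)]$ is feasible. *)

theory Defs
  imports "HOL-Library.Extended_Nonnegative_Real" Complex_Main
begin

text \<open>
  Jobs and machines are named by natural numbers, so that the collection of all instances is a
  set; every finite instance has such a naming. The argument order is \<open>speed I i j\<close> for machine
  \<open>i\<close> and job \<open>j\<close>.
\<close>

record malleable_instance =
  jobs :: "nat set"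
  machines :: "nat set"
  speed :: "nat \<Rightarrow> nat \<Rightarrow> nat"
  ptime :: "nat \<Rightarrow> real \<Rightarrow> ennreal"

definition valid_instance :: "malleable_instance \<Rightarrow> bool" where
  "valid_instance I \<longleftrightarrow>
     finite (jobs I) \<and> finite (machines I) \<and>
     (\<forall>j\<in>jobs I.
        ptime I j 0 = \<infinity> \<and>
        (\<forall>s>0. ptime I j s < \<infinity>) \<and>
        antimono_on {0..} (ptime I j) \<and>
        mono_on {0<..} (\<lambda>s. ennreal s * ptime I j s))"

definition total_speed :: "malleable_instance \<Rightarrow> nat \<Rightarrow> nat set \<Rightarrow> nat" where
  "total_speed I j S = (\<Sum>i\<in>S. speed I i j)"

definition set_ptime :: "malleable_instance \<Rightarrow> nat \<Rightarrow> nat set \<Rightarrow> ennreal" where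
  "set_ptime I j S = ptime I j (real (total_speed I j S))"

text \<open>
  A job may start on a machine at the very moment the previous one ends there, hence the
  half-open occupation intervals.
\<close>

definition feasible_schedule :: "malleable_instance \<Rightarrow> (nat \<Rightarrow> nat set) \<Rightarrow> (nat \<Rightarrow> real) \<Rightarrow> bool" where
  "feasible_schedule I S \<tau> \<longleftrightarrow>
     (\<forall>j\<in>jobs I. S j \<subseteq> machines I \<and> 0 \<le> \<tau> j) \<and>
     (\<forall>i\<in>machines I. \<forall>j\<in>jobs I. \<forall>k\<in>jobs I. j \<noteq> k \<longrightarrow> i \<in> S j \<longrightarrow> i \<in> S k \<longrightarrow>
        {ennreal (\<tau> j)..<ennreal (\<tau> j) + set_ptime I j (S j)} \<inter>
        {ennreal (\<tau> k)..<ennreal (\<tau> k) + set_ptime I k (S k)} = {})"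

definition makespan :: "malleable_instance \<Rightarrow> (nat \<Rightarrow> nat set) \<Rightarrow> (nat \<Rightarrow> real) \<Rightarrow> ennreal" where
  "makespan I S \<tau> = (SUP j\<in>jobs I. ennreal (\<tau> j) + set_ptime I j (S j))"

definition OPT :: "malleable_instance \<Rightarrow> ennreal" where
  "OPT I = Inf {makespan I S \<tau> | S \<tau>. feasible_schedule I S \<tau>}"

definition crit_speed_exists :: "malleable_instance \<Rightarrow> real \<Rightarrow> nat \<Rightarrow> bool" where
  "crit_speed_exists I C j \<longleftrightarrow> (\<exists>q::nat. ptime I j (real q) \<le> ennreal C)"

definition crit_speed :: "malleable_instance \<Rightarrow> real \<Rightarrow> nat \<Rightarrow> nat" where
  "crit_speed I C j = (LEAST q::nat. ptime I j (real q) \<le> ennreal C)"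

definition eff_speed :: "malleable_instance \<Rightarrow> real \<Rightarrow> nat \<Rightarrow> nat \<Rightarrow> nat" where
  "eff_speed I C i j = max (speed I i j) (crit_speed I C j)"

definition LP_solution :: "malleable_instance \<Rightarrow> real \<Rightarrow> (nat \<Rightarrow> nat \<Rightarrow> real) \<Rightarrow> bool" where
  "LP_solution I C x \<longleftrightarrow>
     (\<forall>j\<in>jobs I. (\<Sum>i\<in>machines I. x i j) = 1) \<and>
     (\<forall>i\<in>machines I.
        (\<Sum>j\<in>{j\<in>jobs I. speed I i j \<noteq> 0}.
           ptime I j (real (eff_speed I C i j)) * of_nat (eff_speed I C i j)
             / of_nat (speed I i j) * ennreal (x i j)) \<le> ennreal C) \<and>
     (\<forall>i\<in>machines I. \<forall>j\<in>jobs I. 0 \<le> x i j) \<and>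
     (\<forall>i\<in>machines I. \<forall>j\<in>jobs I. speed I i j = 0 \<longrightarrow> x i j = 0)"

text \<open>A target \<open>C\<close> for which some critical speed does not exist counts as infeasible.\<close>

definition LP_feasible :: "malleable_instance \<Rightarrow> real \<Rightarrow> bool" where
  "LP_feasible I C \<longleftrightarrow> (\<forall>j\<in>jobs I. crit_speed_exists I C j) \<and> (\<exists>x. LP_solution I C x)"

definition LP_value :: "malleable_instance \<Rightarrow> ennreal" where
  "LP_value I = (INF C\<in>{C. 0 < C \<and> LP_feasible I C}. ennreal C)"

text \<open>
  Degenerate instances do not inflate the supremum: \<open>0 / 0 = 0\<close> and \<open>\<infinity> / \<infinity> = 0\<close> in
  \<^typ>\<open>ennreal\<close>. For a valid instance, \<open>LP_value I = 0\<close> forces every processing time at positive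
  speed to be \<open>0\<close> and hence \<open>OPT I = 0\<close>, while \<open>OPT I = \<infinity>\<close> means that some job has speed \<open>0\<close> on
  every machine, whence \<open>LP_value I = \<infinity>\<close>.
\<close>

definition integrality_gap :: ennreal where
  "integrality_gap = (SUP I\<in>{I. valid_instance I}. OPT I / LP_value I)"

definition golden_ratio :: real where
  "golden_ratio = (1 + sqrt 5) / 2"

end

theory Submission
  imports Defs
begin

text \<open>
  With \<open>\<phi>\<close> the golden ratio, take \<open>n\<close> hosts, each serving two private jobs, and one global job that
  takes time \<open>1\<close> on any nonempty set of hosts. A private job takes time \<open>\<phi> / 2\<close> on its host, no
  matter which further machines join in, and can otherwise only run on a private leaf machine,
  where it takes time at least \<open>1 + \<phi>\<close>. Integrally, some host runs the global job; either it also
  runs both of its private jobs, needing \<open>1 + \<phi>\<close> in total, or one of them runs on its leaf alone.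
  Fractionally, the global job is spread evenly over all hosts, and each private job puts a share
  \<open>1 / \<phi>\<close> on its host and \<open>1 / \<phi>\<^sup>2\<close> on its leaf, so that every load is at most \<open>1 + 1 / n\<close>.
\<close>

section \<open>Arithmetic of the golden ratio\<close>

lemma golden_ratio_square: "golden_ratio * golden_ratio = golden_ratio + 1"
proof -
  have "sqrt 5 * sqrt 5 = (5::real)" by simp
  then show ?thesis unfolding golden_ratio_def by (simp add: field_simps)
qed

lemma golden_ratio_bounds: "3 / 2 < golden_ratio" "golden_ratio < 5 / 3"
proof -
  have "2 < sqrt (5::real)" by (rule real_less_rsqrt) simp
  then show "3 / 2 < golden_ratio" unfolding golden_ratio_def by simp
  have "sqrt (5::real) < 7 / 3" by (rule real_less_lsqrt) (simp_all add: power2_eq_square)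
  then show "golden_ratio < 5 / 3" unfolding golden_ratio_def by simp
qed

section \<open>The gap instance and its validity\<close>

text \<open>Speed times processing time of a private job while its speed is too low to reach the
  floor \<open>\<phi> / 2\<close>. It grows with \<open>n\<close> so that rounding the leaf speed to
  an integer becomes negligible.\<close>

definition gap_work :: "nat \<Rightarrow> nat" where
  "gap_work n = 3 * (n + 1)"

text \<open>The number \<open>2 - \<phi>\<close> equals \<open>1 / \<phi>\<^sup>2\<close>.\<close>

definition leaf_speed :: "nat \<Rightarrow> nat" where
  "leaf_speed n = nat \<lfloor>real (gap_work n) * (2 - golden_ratio)\<rfloor>"

text \<open>
  Machine \<open>3 * k\<close> is the \<open>k\<close>-th host, with private jobs \<open>3 * k + 1\<close> and \<open>3 * k + 2\<close>, whose leaves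
  carry the same numbers as the jobs. The global job is \<open>0\<close>.
\<close>

definition gap_instance :: "nat \<Rightarrow> malleable_instance" where
  "gap_instance n = \<lparr>
     jobs = insert 0 {j. j < 3 * n \<and> j mod 3 \<noteq> 0},
     machines = {..<3 * n},
     speed = (\<lambda>i j.
       if j = 0 then (if i mod 3 = 0 then 1 else 0)
       else if i = j then leaf_speed n
       else if i = 3 * (j div 3) then 2 * gap_work n
       else 0),
     ptime = (\<lambda>j s.
       if s = 0 then \<infinity>
       else ennreal (if j = 0 then 1 else max (real (gap_work n) / s) (golden_ratio / 2)))\<rparr>"

lemma gap_instance_simps:
  "jobs (gap_instance n) = insert 0 {j. j < 3 * n \<and> j mod 3 \<noteq> 0}"
  "machines (gap_instance n) = {..<3 * n}"
  "speed (gap_instance n) i j =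
     (if j = 0 then (if i mod 3 = 0 then 1 else 0)
      else if i = j then leaf_speed n
      else if i = 3 * (j div 3) then 2 * gap_work n
      else 0)"
  "ptime (gap_instance n) j s =
     (if s = 0 then \<infinity>
      else ennreal (if j = 0 then 1 else max (real (gap_work n) / s) (golden_ratio / 2)))"
  by (simp_all add: gap_instance_def)

lemma gap_work_pos: "0 < gap_work n"
  by (simp add: gap_work_def)

lemma leaf_speed_upper: "real (leaf_speed n) \<le> real (gap_work n) * (2 - golden_ratio)"
  using golden_ratio_bounds unfolding leaf_speed_def by simp

text \<open>Rounding down loses less than 1. Since \<open>3 * (2 - \<phi>) \<ge> 1\<close>, the
  unrounded speed is at least \<open>n + 1\<close>, so the relative loss fits into a factor
  \<open>1 + 1 / n\<close>.\<close>

lemma leaf_speed_lower: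
  assumes "0 < n"
  shows "real (gap_work n) * (2 - golden_ratio) \<le> (1 + 1 / real n) * real (leaf_speed n)"
proof -
  define z where "z = real (gap_work n) * (2 - golden_ratio)"
  have "real n + 1 \<le> z"
  proof -
    have "(real n + 1) * 1 \<le> (real n + 1) * (3 * (2 - golden_ratio))"
      using golden_ratio_bounds by (intro mult_left_mono) auto
    then show ?thesis by (simp add: z_def gap_work_def algebra_simps)
  qed
  \<comment> \<open>After clearing denominators this is exactly
    \<open>n + 1 \<le> z\<close>.\<close>
  then have "z \<le> (1 + 1 / real n) * (z - 1)"
    using assms by (simp add: field_simps)
  also have "\<dots> \<le> (1 + 1 / real n) * real (leaf_speed n)"
  proof (rule mult_left_mono)
    show "z - 1 \<le> real (leaf_speed n)" unfolding leaf_speed_def z_def by linarith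
  qed simp
  finally show ?thesis by (simp add: z_def)
qed

lemma leaf_speed_pos:
  assumes "0 < n"
  shows "0 < leaf_speed n"
proof (rule ccontr)
  assume "\<not> 0 < leaf_speed n"
  then have "real (gap_work n) * (2 - golden_ratio) \<le> 0"
    using leaf_speed_lower[OF assms] by simp
  moreover have "0 < real (gap_work n) * (2 - golden_ratio)"
    using gap_work_pos golden_ratio_bounds by simp
  ultimately show False by simp
qed

lemma leaf_speed_le_gap_work: "leaf_speed n \<le> gap_work n"
proof -
  have "real (gap_work n) * (2 - golden_ratio) \<le> real (gap_work n) * 1"
    using golden_ratio_bounds by (intro mult_left_mono) auto
  then show ?thesis using leaf_speed_upper[of n] by simp
qed

lemma valid_gap_instance: "valid_instance (gap_instance n)"
  unfolding valid_instance_def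
proof (intro conjI ballI)
  show "finite (jobs (gap_instance n))" "finite (machines (gap_instance n))"
    by (simp_all add: gap_instance_simps)
  fix j
  show "ptime (gap_instance n) j 0 = \<infinity>" "\<forall>s>0. ptime (gap_instance n) j s < \<infinity>"
    by (simp_all add: gap_instance_simps)
  show "antimono_on {0..} (ptime (gap_instance n) j)"
  proof (rule monotone_onI)
    fix s t :: real
    assume "s \<in> {0..}" "t \<in> {0..}" "s \<le> t"
    then show "ptime (gap_instance n) j t \<le> ptime (gap_instance n) j s"
      using gap_work_pos[of n]
      by (auto simp: gap_instance_simps intro!: ennreal_leI max.mono divide_left_mono)
  qed
  show "mono_on {0<..} (\<lambda>s. ennreal s * ptime (gap_instance n) j s)"
  proof (rule monotone_onI)
    fix s t :: real
    assume st: "s \<in> {0<..}" "t \<in> {0<..}" "s \<le> t"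
    \<comment> \<open>Moving the factor \<open>u\<close> into the \<open>max\<close> leaves a
      constant and a linear term, both monotone in \<open>u\<close>.\<close>
    have *: "ennreal u * ptime (gap_instance n) j u =
        ennreal (if j = 0 then u else max (real (gap_work n)) (u * (golden_ratio / 2)))"
      if "0 < u" for u
      using that golden_ratio_bounds
      by (auto simp: gap_instance_simps ennreal_mult[symmetric] max_mult_distrib_left)
    show "ennreal s * ptime (gap_instance n) j s \<le> ennreal t * ptime (gap_instance n) j t"
      using st golden_ratio_bounds
      by (simp only: * greaterThan_iff, intro ennreal_leI, cases "j = 0")
        (simp, simp only: if_False, intro max.mono mult_right_mono, auto)
  qed
qed

section \<open>Extended reals, disjoint intervals and makespans\<close>

lemma ennreal_inverse_antimono:
  fixes a b :: ennreal
  assumes "a \<le> b"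
  shows "inverse b \<le> inverse a"
proof (cases "a = 0 \<or> b = top")
  case False
  then obtain x y where "a = ennreal x" "b = ennreal y" "0 < x" "0 < y"
    using assms by (cases a; cases b) (auto simp: less_le top_unique)
  then show ?thesis
    using assms by (simp add: inverse_ennreal ennreal_leI le_imp_inverse_le)
qed auto

text \<open>Otherwise the later start \<open>max s t\<close> would lie in both intervals. The real
  bounds \<open>p\<close> and \<open>q\<close> stand in for lengths that may be infinite, so that
  schedules can be compared by linear arithmetic.\<close>

lemma disjoint_intervals_ordered:
  assumes "{ennreal s..<ennreal s + P} \<inter> {ennreal t..<ennreal t + Q} = {}"
    and "ennreal p \<le> P" "ennreal q \<le> Q" "0 < p" "0 < q" "0 \<le> s" "0 \<le> t"
  shows "s + p \<le> t \<or> t + q \<le> s"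
proof (rule ccontr)
  assume "\<not> ?thesis"
  then have lt: "t < s + p" "s < t + q" by auto
  have "ennreal (max s t) < ennreal (s + p)" "ennreal (max s t) < ennreal (t + q)"
    using assms lt by (auto simp: ennreal_less_iff simp del: ennreal_plus)
  moreover have "ennreal (s + p) \<le> ennreal s + P" "ennreal (t + q) \<le> ennreal t + Q"
    using assms by (auto simp: ennreal_plus intro: add_left_mono)
  moreover have "ennreal s \<le> ennreal (max s t)" "ennreal t \<le> ennreal (max s t)"
    by (auto intro: ennreal_leI)
  ultimately have "ennreal (max s t) \<in>
      {ennreal s..<ennreal s + P} \<inter> {ennreal t..<ennreal t + Q}"
    by (auto intro: less_le_trans)
  with assms(1) show False by auto
qed

lemma makespan_ge:
  assumes "j \<in> jobs I" "ennreal p \<le> set_ptime I j (S j)" "0 \<le> p" "0 \<le> \<tau> j" "c \<le> \<tau> j + p"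
  shows "ennreal c \<le> makespan I S \<tau>"
proof -
  have "ennreal c \<le> ennreal (\<tau> j) + ennreal p"
    using assms by (simp add: ennreal_plus[symmetric] ennreal_leI del: ennreal_plus)
  also have "\<dots> \<le> ennreal (\<tau> j) + set_ptime I j (S j)"
    using assms by (intro add_left_mono)
  also have "\<dots> \<le> makespan I S \<tau>"
    unfolding makespan_def by (rule SUP_upper) (rule assms)
  finally show ?thesis .
qed

section \<open>Integral schedules of the gap instance\<close>

text \<open>Without the host only the leaf contributes speed, at most
  \<open>gap_work n * (2 - \<phi>)\<close>, and \<open>2 - \<phi>\<close> is the inverse of
  \<open>1 + \<phi>\<close>.\<close>

lemma gap_instance_private_off_host:
  assumes "j \<noteq> 0" "S \<subseteq> {..<3 * n}" "3 * (j div 3) \<notin> S"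
  shows "ennreal (1 + golden_ratio) \<le> set_ptime (gap_instance n) j S"
proof -
  define \<sigma> where "\<sigma> = total_speed (gap_instance n) j S"
  have fin: "finite S" using assms(2) finite_subset by blast
  have "\<sigma> \<le> (\<Sum>i\<in>S. if i = j then leaf_speed n else 0)"
    unfolding \<sigma>_def total_speed_def using assms
    by (intro sum_mono) (auto simp: gap_instance_simps)
  also have "\<dots> \<le> leaf_speed n" using fin by (simp add: sum.delta)
  finally have "\<sigma> \<le> leaf_speed n" .
  then have "real \<sigma> \<le> real (gap_work n) * (2 - golden_ratio)"
    using leaf_speed_upper[of n] by linarith
  then have "real \<sigma> * (1 + golden_ratio) \<le>
      real (gap_work n) * (2 - golden_ratio) * (1 + golden_ratio)"
    using golden_ratio_bounds by (intro mult_right_mono) auto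
  also have "\<dots> = real (gap_work n)"
  proof -
    have "(2 - golden_ratio) * (1 + golden_ratio) = 1"
      using golden_ratio_square by (simp add: algebra_simps)
    then show ?thesis by (simp add: mult.assoc)
  qed
  \<comment> \<open>At speed 0 the real quotient would be 0; there the processing time is infinite
    instead.\<close>
  finally have "1 + golden_ratio \<le> real (gap_work n) / real \<sigma>" if "\<sigma> \<noteq> 0"
    using that by (simp add: field_simps)
  then show ?thesis
    using assms(1) by (auto simp: set_ptime_def \<sigma>_def gap_instance_simps intro!: ennreal_leI)
qed

lemma gap_instance_private_ptime_ge:
  assumes "j \<noteq> 0"
  shows "ennreal (golden_ratio / 2) \<le> set_ptime (gap_instance n) j S"
  using assms by (auto simp: set_ptime_def gap_instance_simps intro!: ennreal_leI)

lemma gap_instance_global_ptime_ge: "ennreal 1 \<le> set_ptime (gap_instance n) 0 S"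
  by (auto simp: set_ptime_def gap_instance_simps)

lemma gap_instance_makespan_ge:
  assumes "feasible_schedule (gap_instance n) S \<tau>"
  shows "ennreal (1 + golden_ratio) \<le> makespan (gap_instance n) S \<tau>"
proof (cases "\<exists>i\<in>S 0. i mod 3 = 0")
  case False
  then have "total_speed (gap_instance n) 0 (S 0) = 0"
    unfolding total_speed_def by (intro sum.neutral) (simp add: gap_instance_simps)
  then have "set_ptime (gap_instance n) 0 (S 0) = \<infinity>"
    by (simp add: set_ptime_def gap_instance_simps)
  then have "ennreal (1 + golden_ratio) \<le> set_ptime (gap_instance n) 0 (S 0)"
    by simp
  then show ?thesis
    using assms golden_ratio_bounds
    by (intro makespan_ge[where j = 0 and p = "1 + golden_ratio"])
      (auto simp: feasible_schedule_def gap_instance_simps)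
next
  case True
  then obtain k where k: "3 * k \<in> S 0" by (auto simp: mod_eq_0_iff_dvd)
  have sub: "S j \<subseteq> {..<3 * n}" "0 \<le> \<tau> j" if "j \<in> jobs (gap_instance n)" for j
    using assms that by (auto simp: feasible_schedule_def gap_instance_simps(2))
  have global: "0 \<in> jobs (gap_instance n)" by (simp add: gap_instance_simps)
  have kn: "k < n" using k sub[OF global] by auto
  define a b where "a = 3 * k + 1" and "b = 3 * k + 2"
  have ab: "a \<in> jobs (gap_instance n)" "b \<in> jobs (gap_instance n)"
      "a \<noteq> 0" "b \<noteq> 0" "a \<noteq> b" "3 * (a div 3) = 3 * k" "3 * (b div 3) = 3 * k"
    using kn by (auto simp: a_def b_def gap_instance_simps) presburger+
  note pos = sub(2)[OF global] sub(2)[OF ab(1)] sub(2)[OF ab(2)]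
  show ?thesis
  proof (cases "3 * k \<in> S a \<and> 3 * k \<in> S b")
    case False
    then obtain j where j: "j \<in> {a, b}" "3 * k \<notin> S j" by auto
    then have "ennreal (1 + golden_ratio) \<le> set_ptime (gap_instance n) j (S j)"
      using ab sub by (intro gap_instance_private_off_host) auto
    then show ?thesis
      using j ab pos golden_ratio_bounds
      by (intro makespan_ge[where j = j and p = "1 + golden_ratio"]) auto
  next
    case True
    have sep: "\<tau> i + p \<le> \<tau> j \<or> \<tau> j + q \<le> \<tau> i"
      if "i \<in> jobs (gap_instance n)" "j \<in> jobs (gap_instance n)" "i \<noteq> j"
        "3 * k \<in> S i" "3 * k \<in> S j" "0 < p" "0 < q"
        "ennreal p \<le> set_ptime (gap_instance n) i (S i)"
        "ennreal q \<le> set_ptime (gap_instance n) j (S j)" for i j p q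
    proof (rule disjoint_intervals_ordered)
      have "3 * k \<in> machines (gap_instance n)" using kn by (simp add: gap_instance_simps)
      then show "{ennreal (\<tau> i)..<ennreal (\<tau> i) + set_ptime (gap_instance n) i (S i)} \<inter>
          {ennreal (\<tau> j)..<ennreal (\<tau> j) + set_ptime (gap_instance n) j (S j)} = {}"
        using assms that unfolding feasible_schedule_def by blast
    qed (use that sub in auto)
    define h where "h = golden_ratio / 2"
    have h: "0 < h" "1 + golden_ratio = 1 + 2 * h" using golden_ratio_bounds by (auto simp: h_def)
    note pt = gap_instance_global_ptime_ge[of n "S 0"]
      gap_instance_private_ptime_ge[OF ab(3), of n "S a", folded h_def]
      gap_instance_private_ptime_ge[OF ab(4), of n "S b", folded h_def]
    have "\<tau> 0 + 1 \<le> \<tau> a \<or> \<tau> a + h \<le> \<tau> 0"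
      using sep[of 0 a 1 h] global ab k True h pt by auto
    moreover have "\<tau> 0 + 1 \<le> \<tau> b \<or> \<tau> b + h \<le> \<tau> 0"
      using sep[of 0 b 1 h] global ab k True h pt by auto
    moreover have "\<tau> a + h \<le> \<tau> b \<or> \<tau> b + h \<le> \<tau> a"
      using sep[of a b h h] ab k True h pt by auto
    \<comment> \<open>Three jobs of lengths at least \<open>1\<close>, \<open>h\<close>,
      \<open>h\<close> share the host, so whichever comes last ends no earlier than
      \<open>1 + 2 * h\<close>.\<close>
    ultimately consider "1 + golden_ratio \<le> \<tau> 0 + 1" | "1 + golden_ratio \<le> \<tau> a + h"
      | "1 + golden_ratio \<le> \<tau> b + h"
      using pos h by linarith
    then show ?thesis
    proof cases
      case 1
      then show ?thesis
        using global pt pos by (intro makespan_ge[where j = 0 and p = 1]) auto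
    next
      case 2
      then show ?thesis
        using ab pt pos h by (intro makespan_ge[where j = a and p = h]) auto
    next
      case 3
      then show ?thesis
        using ab pt pos h by (intro makespan_ge[where j = b and p = h]) auto
    qed
  qed
qed

lemma gap_instance_OPT_ge: "ennreal (1 + golden_ratio) \<le> OPT (gap_instance n)"
  unfolding OPT_def by (rule Inf_greatest) (auto intro: gap_instance_makespan_ge)

section \<open>The fractional solution and its loads\<close>

lemma ennreal_load_term:
  assumes "0 \<le> p" "0 < s" "0 \<le> x"
  shows "ennreal p * of_nat e / of_nat s * ennreal x = ennreal (p * real e / real s * x)"
  using assms
  by (simp add: ennreal_of_nat_eq_real_of_nat ennreal_mult[symmetric] divide_ennreal)

lemma crit_speed_le:
  "ptime I j (real q) \<le> ennreal C \<Longrightarrow> crit_speed I C j \<le> q"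
  unfolding crit_speed_def by (rule Least_le)

text \<open>The host share \<open>\<phi> - 1\<close> equals \<open>1 / \<phi>\<close>, which turns
  the host time \<open>\<phi> / 2\<close> into a load of \<open>1 / 2\<close>.\<close>

definition gap_fraction :: "nat \<Rightarrow> nat \<Rightarrow> nat \<Rightarrow> real" where
  "gap_fraction n i j =
     (if j = 0 then (if i mod 3 = 0 then 1 / real n else 0)
      else if i = j then 2 - golden_ratio
      else if i = 3 * (j div 3) then golden_ratio - 1
      else 0)"

lemma gap_fraction_nonneg: "0 \<le> gap_fraction n i j"
  using golden_ratio_bounds by (auto simp: gap_fraction_def)

lemma gap_fraction_sum:
  assumes "0 < n" "j \<in> jobs (gap_instance n)"
  shows "(\<Sum>i<3 * n. gap_fraction n i j) = 1"
proof (cases "j = 0")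
  case True
  have hosts: "{i \<in> {..<3 * n}. i mod 3 = 0} = (\<lambda>k. 3 * k) ` {..<n}"
    by (auto simp: mod_eq_0_iff_dvd)
  have "(\<Sum>i<3 * n. gap_fraction n i j) = (\<Sum>i\<in>{i \<in> {..<3 * n}. i mod 3 = 0}. 1 / real n)"
    using True by (simp add: gap_fraction_def sum.If_cases Int_def)
  also have "\<dots> = 1"
    using assms unfolding hosts by (subst sum.reindex) (auto simp: inj_on_def)
  finally show ?thesis .
next
  case False
  with assms have j: "j < 3 * n" "3 * (j div 3) < 3 * n" "3 * (j div 3) \<noteq> j"
    by (auto simp: gap_instance_simps) presburger+
  have "(\<Sum>i<3 * n. gap_fraction n i j) = (\<Sum>i\<in>{j, 3 * (j div 3)}. gap_fraction n i j)"
    using j False by (intro sum.mono_neutral_right) (auto simp: gap_fraction_def)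
  also have "\<dots> = 1" using j False by (simp add: gap_fraction_def)
  finally show ?thesis .
qed

text \<open>At these speeds the jobs take time exactly 1. Upper bounds suffice: on a host its own
  speed then wins the \<open>max\<close>, and on a leaf the effective speed cancels.\<close>

lemma gap_instance_crit_speed:
  assumes "1 \<le> C"
  shows "crit_speed (gap_instance n) C 0 \<le> 1"
    and "j \<noteq> 0 \<Longrightarrow> crit_speed (gap_instance n) C j \<le> gap_work n"
  using assms gap_work_pos[of n] golden_ratio_bounds
  by (auto intro!: crit_speed_le simp: gap_instance_simps)

lemma gap_instance_LP_solution:
  assumes "0 < n"
  shows "LP_solution (gap_instance n) (1 + 1 / real n) (gap_fraction n)"
  unfolding LP_solution_def
proof (intro conjI ballI)
  fix j assume "j \<in> jobs (gap_instance n)"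
  then show "(\<Sum>i\<in>machines (gap_instance n). gap_fraction n i j) = 1"
    using gap_fraction_sum[OF assms] by (simp add: gap_instance_simps(2))
next
  fix i j
  show "0 \<le> gap_fraction n i j" by (rule gap_fraction_nonneg)
  show "speed (gap_instance n) i j = 0 \<longrightarrow> gap_fraction n i j = 0"
    using leaf_speed_pos[OF assms] gap_work_pos[of n]
    by (auto simp: gap_instance_simps gap_fraction_def split: if_splits)
next
  define C where "C = 1 + 1 / real n"
  have C: "1 \<le> C" by (simp add: C_def)
  define load where "load i j = ptime (gap_instance n) j (real (eff_speed (gap_instance n) C i j)) *
    of_nat (eff_speed (gap_instance n) C i j) / of_nat (speed (gap_instance n) i j) *
    ennreal (gap_fraction n i j)" for i j
  fix i assume i: "i \<in> machines (gap_instance n)"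
  have "(\<Sum>j\<in>{j \<in> jobs (gap_instance n). speed (gap_instance n) i j \<noteq> 0}. load i j) \<le> ennreal C"
  proof (cases "i mod 3 = 0")
    case True
    then obtain k where k: "i = 3 * k" by (auto simp: mod_eq_0_iff_dvd)
    have common: "load i 0 = ennreal (1 / real n)"
    proof -
      have "eff_speed (gap_instance n) C i 0 = 1"
        using gap_instance_crit_speed(1)[OF C, of n] k
        by (simp add: eff_speed_def gap_instance_simps)
      then show ?thesis using k by (simp add: load_def gap_instance_simps gap_fraction_def)
    qed
    have own: "load i j = ennreal (1 / 2)" if "j \<noteq> 0" "i \<noteq> j" "i = 3 * (j div 3)" for j
    proof -
      have sp: "speed (gap_instance n) i j = 2 * gap_work n"
        using that by (simp add: gap_instance_simps)
      then have eff: "eff_speed (gap_instance n) C i j = 2 * gap_work n"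
        using gap_instance_crit_speed(2)[OF C that(1), of n] by (simp add: eff_speed_def)
      \<comment> \<open>At host speed the quotient is \<open>1 / 2\<close>, below the floor
        \<open>\<phi> / 2\<close>.\<close>
      have pt: "ptime (gap_instance n) j (real (2 * gap_work n)) = ennreal (golden_ratio / 2)"
        using that(1) gap_work_pos[of n] golden_ratio_bounds by (simp add: gap_instance_simps max_def)
      have fr: "gap_fraction n i j = golden_ratio - 1"
        using that by (simp add: gap_fraction_def)
      have "load i j = ennreal (golden_ratio / 2 * real (2 * gap_work n) / real (2 * gap_work n) *
          (golden_ratio - 1))"
        unfolding load_def sp eff pt fr
        using gap_work_pos[of n] golden_ratio_bounds by (intro ennreal_load_term) auto
      also have "golden_ratio / 2 * real (2 * gap_work n) / real (2 * gap_work n) *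
          (golden_ratio - 1) = 1 / 2"
        using golden_ratio_square gap_work_pos[of n] by (simp add: field_simps)
      finally show ?thesis .
    qed
    \<comment> \<open>The host's own number \<open>3 * k\<close> is a job only for
      \<open>k = 0\<close>, where it is the global job.\<close>
    have "{j \<in> jobs (gap_instance n). speed (gap_instance n) i j \<noteq> 0} \<subseteq> {0, 3 * k + 1, 3 * k + 2}"
      by (auto simp: k gap_instance_simps split: if_splits) presburger+
    then have "(\<Sum>j\<in>{j \<in> jobs (gap_instance n). speed (gap_instance n) i j \<noteq> 0}. load i j)
        \<le> (\<Sum>j\<in>{0, 3 * k + 1, 3 * k + 2}. load i j)"
      by (intro sum_mono2) auto
    also have "\<dots> = load i 0 + (load i (3 * k + 1) + load i (3 * k + 2))"
      by simp
    also have "\<dots> = ennreal (1 / real n) + (ennreal (1 / 2) + ennreal (1 / 2))"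
    proof -
      have "load i (3 * k + 1) = ennreal (1 / 2)" "load i (3 * k + 2) = ennreal (1 / 2)"
        by (rule own; simp add: k)+
      then show ?thesis using common by simp
    qed
    also have "\<dots> = ennreal (1 / real n + (1 / 2 + 1 / 2))"
      by (simp only: ennreal_plus zero_le_divide_1_iff of_nat_0_le_iff zero_le_numeral add_nonneg_nonneg)
    also have "\<dots> = ennreal C" by (simp add: C_def add.commute)
    finally show ?thesis .
  next
    case False
    then have i0: "i \<noteq> 0" by auto
    have "{j \<in> jobs (gap_instance n). speed (gap_instance n) i j \<noteq> 0} \<subseteq> {i}"
      using False by (auto simp: gap_instance_simps split: if_splits)
    then have "(\<Sum>j\<in>{j \<in> jobs (gap_instance n). speed (gap_instance n) i j \<noteq> 0}. load i j)
        \<le> (\<Sum>j\<in>{i}. load i j)"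
      by (intro sum_mono2) auto
    also have "\<dots> = load i i" by simp
    also have "\<dots> \<le> ennreal C"
    proof -
      define e where "e = eff_speed (gap_instance n) C i i"
      have sp: "speed (gap_instance n) i i = leaf_speed n"
        using i0 by (simp add: gap_instance_simps)
      have e: "0 < e" "e \<le> gap_work n"
        using gap_instance_crit_speed(2)[OF C i0, of n] leaf_speed_le_gap_work[of n]
          leaf_speed_pos[OF assms]
        by (auto simp: e_def eff_speed_def sp)
      \<comment> \<open>An effective speed up to \<open>gap_work n\<close> keeps the quotient above
        the floor, so the product of time and effective speed is \<open>gap_work n\<close>, whatever
        \<open>e\<close> is.\<close>
      have "real e * (golden_ratio / 2) \<le> real (gap_work n) * 1"
        using e golden_ratio_bounds by (intro mult_mono) auto
      then have "golden_ratio / 2 \<le> real (gap_work n) / real e"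
        using e by (simp add: field_simps)
      then have pt: "ptime (gap_instance n) i (real e) = ennreal (real (gap_work n) / real e)"
        using i0 e by (simp add: gap_instance_simps max_absorb1)
      have fr: "gap_fraction n i i = 2 - golden_ratio"
        using i0 by (simp add: gap_fraction_def)
      have "load i i = ennreal (real (gap_work n) / real e * real e / real (leaf_speed n) *
          (2 - golden_ratio))"
        unfolding load_def e_def[symmetric] sp pt fr
        using leaf_speed_pos[OF assms] golden_ratio_bounds by (intro ennreal_load_term) auto
      \<comment> \<open>Once \<open>e\<close> cancels, the load is the unrounded leaf speed over the
        rounded one, and the rounding bound applies.\<close>
      also have "\<dots> \<le> ennreal C"
        using leaf_speed_lower[OF assms] leaf_speed_pos[OF assms] e
        by (intro ennreal_leI) (simp add: C_def pos_divide_le_eq)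
      finally show ?thesis .
    qed
    finally show ?thesis .
  qed
  then show "(\<Sum>j\<in>{j \<in> jobs (gap_instance n). speed (gap_instance n) i j \<noteq> 0}.
      ptime (gap_instance n) j (real (eff_speed (gap_instance n) (1 + 1 / real n) i j)) *
      of_nat (eff_speed (gap_instance n) (1 + 1 / real n) i j) /
      of_nat (speed (gap_instance n) i j) * ennreal (gap_fraction n i j))
    \<le> ennreal (1 + 1 / real n)"
    by (simp only: load_def C_def)
qed

lemma gap_instance_LP_value_le:
  assumes "0 < n"
  shows "LP_value (gap_instance n) \<le> ennreal (1 + 1 / real n)"
proof -
  have "crit_speed_exists (gap_instance n) (1 + 1 / real n) j" for j
    unfolding crit_speed_exists_def using gap_work_pos[of n] golden_ratio_bounds
    \<comment> \<open>At speed \<open>gap_work n\<close> every job takes time 1, because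
      \<open>\<phi> / 2 < 1\<close>.\<close>
    by (intro exI[of _ "gap_work n"]) (auto simp: gap_instance_simps intro!: ennreal_leI)
  then have "LP_feasible (gap_instance n) (1 + 1 / real n)"
    unfolding LP_feasible_def using gap_instance_LP_solution[OF assms] by blast
  moreover have "0 < 1 + 1 / real n" by (simp add: add_pos_nonneg)
  ultimately show ?thesis unfolding LP_value_def by (intro INF_lower) simp
qed

theorem theorem5p2: "integrality_gap \<ge> ennreal (1 + golden_ratio)"
proof -
  have bound: "ennreal ((1 + golden_ratio) / (1 + 1 / real n)) \<le> integrality_gap"
    if "1 \<le> n" for n
  proof -
    have "ennreal ((1 + golden_ratio) / (1 + 1 / real n)) =
        ennreal (1 + golden_ratio) / ennreal (1 + 1 / real n)"
      using golden_ratio_bounds by (intro divide_ennreal[symmetric]) (auto simp: add_pos_nonneg)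
    \<comment> \<open>The numerator grows to the optimum while the denominator shrinks to the LP
      value.\<close>
    also have "\<dots> \<le> OPT (gap_instance n) / LP_value (gap_instance n)"
      unfolding divide_ennreal_def using gap_instance_LP_value_le[of n] that
      by (intro mult_mono gap_instance_OPT_ge ennreal_inverse_antimono) auto
    also have "\<dots> \<le> integrality_gap"
      unfolding integrality_gap_def by (rule SUP_upper) (simp add: valid_gap_instance)
    finally show ?thesis .
  qed
  \<comment> \<open>Each single instance only gives a ratio bound below \<open>1 + \<phi>\<close>;
    the supremum absorbs the limit in \<open>n\<close>.\<close>
  have "(\<lambda>n. (1 + golden_ratio) / (1 + 1 / real n)) \<longlonglongrightarrow> (1 + golden_ratio) / (1 + 0)"
    by (intro tendsto_intros lim_1_over_n) simp
  then have "(\<lambda>n. ennreal ((1 + golden_ratio) / (1 + 1 / real n))) \<longlonglongrightarrow> ennreal (1 + golden_ratio)"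
    by (intro tendsto_ennrealI) simp
  then show ?thesis
    by (rule LIMSEQ_le_const2) (use bound in blast)
qed

end
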